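(* Let $G$ be a group (written multiplicatively) and let $\alpha\in\mathrm{Aut}(G)$ satisfy $\alpha^2=1$. Define a new binary operation on the set $G$ by $a*b:=\alpha(a)b$. Then $G_\alpha=(G,* )$ is a Bol$^\ast$ quasigroup. Furthermore, every Bol$^\ast$ quasigroup is obtainable in this way, i.e. equals $G_\alpha$ for some group $G$ and some $\alpha\in\mathrm{Aut}(G)$ with $\alpha^2=1$. Finally, given groups $G,H$ and automorphisms $\alpha\in\mathrm{Aut}(G)$, $\beta\in\mathrm{Aut}(H)$ with $\alpha^2=1$ and $\beta^2=1$, the Bol$^\ast$ quasigroups $G_\alpha$ and $H_\beta$ are isomorphic if and only if the groups $G$ and $H$ are isomorphic and the automorphisms $\alpha$ and $\beta$ are conjugate, i.e. there is a group isomorphism $\pi:G\to H$ with $\pi\alpha\pi^{-1}=\beta$.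
   Context: A quasigroup is a nonempty set with a binary operation for which all left translations $z\mapsto xz$ and all right translations $z\mapsto zx$ are bijections. A (right) Bol$^\ast$ quasigroup is a quasigroup satisfying $a((bc)d)=((ab)c)d$ for all elements $a,b,c,d$. An isomorphism of quasigroups is a bijection preserving the binary operation. The automorphism $\alpha$ is allowed to be the identity. *)

theory Defs
  imports "HOL-Algebra.Bij"
begin

record 'a magma = "'a partial_object" +
  qmult :: "'a \<Rightarrow> 'a \<Rightarrow> 'a" (infixl "\<cdot>\<index>" 70)

locale quasigroup =
  fixes Q :: "'a magma" (structure)
  assumes nonempty: "carrier Q \<noteq> {}"
    and left_translation: "x \<in> carrier Q \<Longrightarrow> bij_betw (\<lambda>z. x \<cdot> z) (carrier Q) (carrier Q)"
    and right_translation: "x \<in> carrier Q \<Longrightarrow> bij_betw (\<lambda>z. z \<cdot> x) (carrier Q) (carrier Q)"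

locale bol_star_quasigroup = quasigroup +
  assumes bol_star:
    "\<lbrakk>a \<in> carrier Q; b \<in> carrier Q; c \<in> carrier Q; d \<in> carrier Q\<rbrakk>
      \<Longrightarrow> a \<cdot> ((b \<cdot> c) \<cdot> d) = ((a \<cdot> b) \<cdot> c) \<cdot> d"

definition magma_iso :: "'a magma \<Rightarrow> 'b magma \<Rightarrow> ('a \<Rightarrow> 'b) set" where
  "magma_iso Q R = {f. bij_betw f (carrier Q) (carrier R) \<and>
     (\<forall>x\<in>carrier Q. \<forall>y\<in>carrier Q. f (x \<cdot>\<^bsub>Q\<^esub> y) = f x \<cdot>\<^bsub>R\<^esub> f y)}"

(* Equality of magmas as mathematical structures: record equality would also compare the
   irrelevant values of the operations outside the carrier. *)
definition magma_eq :: "'a magma \<Rightarrow> 'a magma \<Rightarrow> bool" where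
  "magma_eq Q R \<longleftrightarrow> carrier Q = carrier R \<and>
     (\<forall>x\<in>carrier Q. \<forall>y\<in>carrier Q. x \<cdot>\<^bsub>Q\<^esub> y = x \<cdot>\<^bsub>R\<^esub> y)"

definition twist :: "'a monoid \<Rightarrow> ('a \<Rightarrow> 'a) \<Rightarrow> 'a magma" where
  "twist G \<alpha> = \<lparr>carrier = carrier G, qmult = (\<lambda>a b. \<alpha> a \<otimes>\<^bsub>G\<^esub> b)\<rparr>"

(* The square is taken in Aut(G), so the identity automorphism is included. *)
definition involutive_aut :: "'a monoid \<Rightarrow> ('a \<Rightarrow> 'a) \<Rightarrow> bool" where
  "involutive_aut G \<alpha> \<longleftrightarrow> \<alpha> \<in> carrier (AutoGroup G) \<and>
     \<alpha> [^]\<^bsub>AutoGroup G\<^esub> (2::nat) = \<one>\<^bsub>AutoGroup G\<^esub>"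

end

theory Submission
  imports Defs
begin

text \<open>
  In \<open>G\<^sub>\<alpha>\<close> the neutral element \<open>1\<close> of the group is a left identity and \<open>a * 1 = \<alpha> a\<close>, so both the
  automorphism and the group product \<open>a b = (a * 1) * b\<close> can be read off from \<open>*\<close> once that
  element is known. Both the converse and the isomorphism criterion rest on this observation.

  A twist satisfies the Bol* law because, \<open>\<alpha>\<close> being an involutive homomorphism, both sides of the
  law equal \<open>\<alpha> a b (\<alpha> c) d\<close>.

  For the converse, take any \<open>b\<close> in a Bol* quasigroup and solve \<open>e b = b\<close>. The Bol* law then says
  that \<open>e\<close> fixes \<open>(b c) d\<close> for all \<open>c, d\<close>, that is, every element, so \<open>e\<close> is a left
  identity. Put \<open>\<phi> a = a e\<close>. Inserting \<open>e\<close> for the second variable of the law gives the weak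
  associativity \<open>a (c d) = (\<phi> a c) d\<close>. It shows that \<open>\<phi>\<close> is an involution, that
  \<open>(a, b) \<mapsto> \<phi> a b\<close> is a group operation with neutral element \<open>e\<close>, and that \<open>\<phi>\<close> is an
  automorphism of this group, whose twist by \<open>\<phi>\<close> is the original operation.

  A group isomorphism intertwining the automorphisms plainly respects the twisted operations.
  Conversely, an isomorphism of twists must send \<open>1\<close> to \<open>1\<close>; hence it commutes with
  \<open>a \<mapsto> a * 1\<close>, which is the automorphism, and with the group product recovered from \<open>*\<close>.
  The same map therefore serves in both directions.
\<close>

text \<open>
  Bijectivity is absent from the right-hand side because an involution is its own inverse.
\<close>

lemma involutive_aut_iff:
  assumes "group G"
  shows "involutive_aut G \<alpha> \<longleftrightarrow>
    \<alpha> \<in> hom G G \<and> \<alpha> \<in> extensional (carrier G) \<and> (\<forall>x\<in>carrier G. \<alpha> (\<alpha> x) = x)"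
proof -
  interpret A: group "AutoGroup G"
    using group.AutoGroup[OF assms] .
  have square: "\<alpha> [^]\<^bsub>AutoGroup G\<^esub> (2::nat) = compose (carrier G) \<alpha> \<alpha>"
    if "\<alpha> \<in> carrier (AutoGroup G)"
  proof -
    have "\<alpha> [^]\<^bsub>AutoGroup G\<^esub> (2::nat) = \<alpha> \<otimes>\<^bsub>AutoGroup G\<^esub> \<alpha>"
      using that by (simp add: numeral_2_eq_2)
    then show ?thesis
      using that by (auto simp: AutoGroup_def BijGroup_def auto_def)
  qed
  have one: "\<one>\<^bsub>AutoGroup G\<^esub> = (\<lambda>x\<in>carrier G. x)"
    by (simp add: AutoGroup_def BijGroup_def)
  have mem: "\<alpha> \<in> carrier (AutoGroup G) \<longleftrightarrow>
      \<alpha> \<in> hom G G \<and> \<alpha> \<in> extensional (carrier G) \<and> bij_betw \<alpha> (carrier G) (carrier G)"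
    by (auto simp: AutoGroup_def auto_def Bij_def)
  have id_iff: "compose (carrier G) \<alpha> \<alpha> = (\<lambda>x\<in>carrier G. x) \<longleftrightarrow>
      (\<forall>x\<in>carrier G. \<alpha> (\<alpha> x) = x)"
    by (auto simp: compose_def restrict_def fun_eq_iff)
  have bij: "bij_betw \<alpha> (carrier G) (carrier G)"
    if "\<alpha> \<in> hom G G" "\<forall>x\<in>carrier G. \<alpha> (\<alpha> x) = x"
    using that by (intro bij_betwI[where g = \<alpha>]) (auto simp: hom_def)
  show ?thesis
    unfolding involutive_aut_def using square one mem id_iff bij by metis
qed

lemma involutive_autD:
  assumes "group G" "involutive_aut G \<alpha>"
  shows "\<And>x. x \<in> carrier G \<Longrightarrow> \<alpha> x \<in> carrier G"
    and "\<And>x y. \<lbrakk>x \<in> carrier G; y \<in> carrier G\<rbrakk> \<Longrightarrow> \<alpha> (x \<otimes>\<^bsub>G\<^esub> y) = \<alpha> x \<otimes>\<^bsub>G\<^esub> \<alpha> y"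
    and "\<And>x. x \<in> carrier G \<Longrightarrow> \<alpha> (\<alpha> x) = x"
    and "\<alpha> \<one>\<^bsub>G\<^esub> = \<one>\<^bsub>G\<^esub>"
  using assms involutive_aut_iff[OF assms(1), of \<alpha>] hom_one[of \<alpha> G G]
  by (auto simp: hom_def)

lemma carrier_twist [simp]: "carrier (twist G \<alpha>) = carrier G"
  by (simp add: twist_def)

lemma qmult_twist [simp]: "a \<cdot>\<^bsub>twist G \<alpha>\<^esub> b = \<alpha> a \<otimes>\<^bsub>G\<^esub> b"
  by (simp add: twist_def)

lemma bol_star_quasigroup_twist:
  assumes "group G" "involutive_aut G \<alpha>"
  shows "bol_star_quasigroup (twist G \<alpha>)"
proof -
  interpret group G by fact
  note \<alpha> = involutive_autD[OF assms]
  show ?thesis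
  proof (unfold_locales, unfold carrier_twist qmult_twist)
    show "carrier G \<noteq> {}"
      by blast
    show "bij_betw (\<lambda>z. \<alpha> x \<otimes>\<^bsub>G\<^esub> z) (carrier G) (carrier G)" if "x \<in> carrier G" for x
      using that \<alpha>(1)
      by (intro bij_betwI[where g = "\<lambda>z. inv\<^bsub>G\<^esub> \<alpha> x \<otimes>\<^bsub>G\<^esub> z"]) (auto simp flip: m_assoc)
    show "bij_betw (\<lambda>z. \<alpha> z \<otimes>\<^bsub>G\<^esub> x) (carrier G) (carrier G)" if "x \<in> carrier G" for x
      using that \<alpha>
      by (intro bij_betwI[where g = "\<lambda>z. \<alpha> (z \<otimes>\<^bsub>G\<^esub> inv\<^bsub>G\<^esub> x)"]) (auto simp: m_assoc)
    show "\<alpha> a \<otimes>\<^bsub>G\<^esub> (\<alpha> (\<alpha> b \<otimes>\<^bsub>G\<^esub> c) \<otimes>\<^bsub>G\<^esub> d) = \<alpha> (\<alpha> (\<alpha> a \<otimes>\<^bsub>G\<^esub> b) \<otimes>\<^bsub>G\<^esub> c) \<otimes>\<^bsub>G\<^esub> d"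
      if "a \<in> carrier G" "b \<in> carrier G" "c \<in> carrier G" "d \<in> carrier G" for a b c d
      using that \<alpha> by (simp add: m_assoc)
  qed
qed

context quasigroup
begin

lemma mult_closed [simp]: "\<lbrakk>x \<in> carrier Q; y \<in> carrier Q\<rbrakk> \<Longrightarrow> x \<cdot> y \<in> carrier Q"
  using bij_betwE[OF left_translation[of x]] by blast

lemma right_cancel: "\<lbrakk>x \<cdot> z = y \<cdot> z; x \<in> carrier Q; y \<in> carrier Q; z \<in> carrier Q\<rbrakk> \<Longrightarrow> x = y"
  using bij_betw_imp_inj_on[OF right_translation[of z]] by (auto dest: inj_onD)

lemma left_divide:
  assumes "a \<in> carrier Q" "b \<in> carrier Q"
  obtains x where "x \<in> carrier Q" "a \<cdot> x = b"
proof -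
  have "b \<in> (\<lambda>z. a \<cdot> z) ` carrier Q"
    using bij_betw_imp_surj_on[OF left_translation[OF assms(1)]] assms(2) by simp
  then show ?thesis
    using that by auto
qed

lemma right_divide:
  assumes "a \<in> carrier Q" "b \<in> carrier Q"
  obtains x where "x \<in> carrier Q" "x \<cdot> a = b"
proof -
  have "b \<in> (\<lambda>z. z \<cdot> a) ` carrier Q"
    using bij_betw_imp_surj_on[OF right_translation[OF assms(1)]] assms(2) by simp
  then show ?thesis
    using that by auto
qed

end

context bol_star_quasigroup
begin

lemma left_identity_exists:
  obtains e where "e \<in> carrier Q" "\<And>x. x \<in> carrier Q \<Longrightarrow> e \<cdot> x = x"
proof -
  obtain b where b: "b \<in> carrier Q"
    using nonempty by blast
  obtain e where e: "e \<in> carrier Q" "e \<cdot> b = b"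
    using right_divide[OF b b] .
  have "e \<cdot> x = x" if x: "x \<in> carrier Q" for x
  proof -
    obtain d where d: "d \<in> carrier Q" "(b \<cdot> b) \<cdot> d = x"
      using left_divide[of "b \<cdot> b" x] b x by auto
    then show ?thesis
      using bol_star[of e b b d] b e by simp
  qed
  then show ?thesis
    using that e(1) by blast
qed

text \<open>
  The group is \<open>a, b \<mapsto> (a e) b\<close>, and the automorphism is right translation by the left identity
  \<open>e\<close>. It is cut down to the carrier because the elements of the automorphism group are
  extensional functions.
\<close>

lemma equals_twist:
  "\<exists>(G :: 'a monoid) \<alpha>. group G \<and> involutive_aut G \<alpha> \<and> magma_eq Q (twist G \<alpha>)"
proof -
  obtain e where e [simp]: "e \<in> carrier Q" and left_id [simp]: "\<And>x. x \<in> carrier Q \<Longrightarrow> e \<cdot> x = x"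
    using left_identity_exists by blast
  define \<phi> where "\<phi> a = a \<cdot> e" for a
  have closed [simp]: "\<phi> a \<in> carrier Q" if "a \<in> carrier Q" for a
    using that by (simp add: \<phi>_def)
  have weak_assoc: "a \<cdot> (c \<cdot> d) = (\<phi> a \<cdot> c) \<cdot> d"
    if "a \<in> carrier Q" "c \<in> carrier Q" "d \<in> carrier Q" for a c d
    using bol_star[of a e c d] that by (simp add: \<phi>_def)
  have invol [simp]: "\<phi> (\<phi> a) = a" if a: "a \<in> carrier Q" for a
  proof (rule right_cancel[of _ e])
    show "\<phi> (\<phi> a) \<cdot> e = a \<cdot> e"
      using weak_assoc[of a e e] a by (simp add: \<phi>_def)
  qed (use a in auto)
  have \<phi>_hom: "\<phi> (\<phi> a \<cdot> b) = a \<cdot> \<phi> b" if "a \<in> carrier Q" "b \<in> carrier Q" for a b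
    using weak_assoc[of a b e] that by (simp add: \<phi>_def)
  define G :: "'a monoid" where
    "G = \<lparr>carrier = carrier Q, mult = (\<lambda>a b. \<phi> a \<cdot> b), one = e\<rparr>"
  have G [simp]: "carrier G = carrier Q" "\<one>\<^bsub>G\<^esub> = e" "a \<otimes>\<^bsub>G\<^esub> b = \<phi> a \<cdot> b" for a b
    by (simp_all add: G_def)
  have group: "group G"
  proof (rule groupI, unfold G)
    show "\<phi> (\<phi> a \<cdot> b) \<cdot> c = \<phi> a \<cdot> (\<phi> b \<cdot> c)"
      if "a \<in> carrier Q" "b \<in> carrier Q" "c \<in> carrier Q" for a b c
      using that by (simp add: \<phi>_hom weak_assoc)
    show "\<phi> e \<cdot> a = a" if "a \<in> carrier Q" for a
      using that by (simp add: \<phi>_def)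
    show "\<exists>b\<in>carrier Q. \<phi> b \<cdot> a = e" if a: "a \<in> carrier Q" for a
    proof -
      obtain b where "b \<in> carrier Q" "b \<cdot> a = e"
        using right_divide[OF a e] .
      then have "\<phi> b \<in> carrier Q" "\<phi> (\<phi> b) \<cdot> a = e"
        by simp_all
      then show ?thesis
        by blast
    qed
  qed simp_all
  have "involutive_aut G (restrict \<phi> (carrier Q))"
    unfolding involutive_aut_iff[OF group] by (auto simp: hom_def \<phi>_hom)
  moreover have "magma_eq Q (twist G (restrict \<phi> (carrier Q)))"
    by (simp add: magma_eq_def)
  ultimately show ?thesis
    using group by blast
qed

end

text \<open>
  An isomorphism \<open>f\<close> of twists sends \<open>1\<close> to an element \<open>h\<close> with \<open>h = \<beta> h h\<close>, which forces
  \<open>h = 1\<close>. After that, the translation \<open>a \<mapsto> a * 1\<close> shows that \<open>f\<close> intertwines \<open>\<alpha>\<close> and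
  \<open>\<beta>\<close>, and then that it respects the products.
\<close>

lemma magma_iso_twist_iff:
  assumes G: "group G" "involutive_aut G \<alpha>" and H: "group H" "involutive_aut H \<beta>"
  shows "f \<in> magma_iso (twist G \<alpha>) (twist H \<beta>) \<longleftrightarrow>
    f \<in> iso G H \<and> (\<forall>x\<in>carrier G. f (\<alpha> x) = \<beta> (f x))"
proof -
  interpret G: group G by fact
  interpret H: group H by fact
  note \<alpha> [simp] = involutive_autD[OF G]
  note \<beta> [simp] = involutive_autD[OF H]
  show ?thesis
  proof
    assume f: "f \<in> magma_iso (twist G \<alpha>) (twist H \<beta>)"
    then have bij: "bij_betw f (carrier G) (carrier H)"
      and mult: "\<And>x y. \<lbrakk>x \<in> carrier G; y \<in> carrier G\<rbrakk> \<Longrightarrow> f (\<alpha> x \<otimes>\<^bsub>G\<^esub> y) = \<beta> (f x) \<otimes>\<^bsub>H\<^esub> f y"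
      by (auto simp: magma_iso_def)
    have cl [simp]: "f x \<in> carrier H" if "x \<in> carrier G" for x
      using bij that by (auto dest: bij_betwE)
    have "f \<one>\<^bsub>G\<^esub> = \<beta> (f \<one>\<^bsub>G\<^esub>) \<otimes>\<^bsub>H\<^esub> f \<one>\<^bsub>G\<^esub>"
      using mult[of "\<one>\<^bsub>G\<^esub>" "\<one>\<^bsub>G\<^esub>"] by simp
    then have "\<beta> (f \<one>\<^bsub>G\<^esub>) = \<one>\<^bsub>H\<^esub>"
      by (metis H.r_cancel_one' \<beta>(1) cl G.one_closed)
    then have one: "f \<one>\<^bsub>G\<^esub> = \<one>\<^bsub>H\<^esub>"
      by (metis \<beta>(3,4) cl G.one_closed)
    have comm: "f (\<alpha> x) = \<beta> (f x)" if "x \<in> carrier G" for x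
      using mult[of x "\<one>\<^bsub>G\<^esub>"] that by (simp add: one)
    have "f (x \<otimes>\<^bsub>G\<^esub> y) = f x \<otimes>\<^bsub>H\<^esub> f y" if "x \<in> carrier G" "y \<in> carrier G" for x y
      using mult[of "\<alpha> x" y] that by (simp add: comm)
    then show "f \<in> iso G H \<and> (\<forall>x\<in>carrier G. f (\<alpha> x) = \<beta> (f x))"
      using bij comm by (auto simp: iso_def hom_def)
  next
    assume "f \<in> iso G H \<and> (\<forall>x\<in>carrier G. f (\<alpha> x) = \<beta> (f x))"
    then show "f \<in> magma_iso (twist G \<alpha>) (twist H \<beta>)"
      by (auto simp: magma_iso_def iso_def hom_def)
  qed
qed

lemma conjugate_iff_intertwines:
  assumes "bij_betw f A B"
  shows "(\<forall>y\<in>B. f (\<alpha> (inv_into A f y)) = \<beta> y) \<longleftrightarrow> (\<forall>x\<in>A. f (\<alpha> x) = \<beta> (f x))"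
  using assms by (auto simp: bij_betw_def)

theorem theorem4:
  "(\<forall>(G :: 'a monoid) \<alpha>. group G \<and> involutive_aut G \<alpha> \<longrightarrow> bol_star_quasigroup (twist G \<alpha>))
   \<and> (\<forall>Q :: 'a magma. bol_star_quasigroup Q \<longrightarrow>
        (\<exists>(G :: 'a monoid) \<alpha>. group G \<and> involutive_aut G \<alpha> \<and> magma_eq Q (twist G \<alpha>)))
   \<and> (\<forall>(G :: 'a monoid) (H :: 'b monoid) \<alpha> \<beta>.
        group G \<and> group H \<and> involutive_aut G \<alpha> \<and> involutive_aut H \<beta> \<longrightarrow>
        (magma_iso (twist G \<alpha>) (twist H \<beta>) \<noteq> {} \<longleftrightarrow>
         (\<exists>\<pi> \<in> iso G H. \<forall>y \<in> carrier H. \<pi> (\<alpha> (inv_into (carrier G) \<pi> y)) = \<beta> y)))"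
proof (intro conjI allI impI; (elim conjE)?)
  fix G :: "'a monoid" and \<alpha>
  assume "group G" "involutive_aut G \<alpha>"
  then show "bol_star_quasigroup (twist G \<alpha>)"
    by (rule bol_star_quasigroup_twist)
next
  fix Q :: "'a magma"
  assume "bol_star_quasigroup Q"
  then show "\<exists>(G :: 'a monoid) \<alpha>. group G \<and> involutive_aut G \<alpha> \<and> magma_eq Q (twist G \<alpha>)"
    by (rule bol_star_quasigroup.equals_twist)
next
  fix G :: "'a monoid" and H :: "'b monoid" and \<alpha> \<beta>
  assume "group G" "group H" "involutive_aut G \<alpha>" "involutive_aut H \<beta>"
  then have "\<pi> \<in> magma_iso (twist G \<alpha>) (twist H \<beta>) \<longleftrightarrow>
      \<pi> \<in> iso G H \<and> (\<forall>y\<in>carrier H. \<pi> (\<alpha> (inv_into (carrier G) \<pi> y)) = \<beta> y)" for \<pi>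
    using conjugate_iff_intertwines[of \<pi> "carrier G" "carrier H" \<alpha> \<beta>]
    by (auto simp: magma_iso_twist_iff iso_def)
  then show "magma_iso (twist G \<alpha>) (twist H \<beta>) \<noteq> {} \<longleftrightarrow>
      (\<exists>\<pi> \<in> iso G H. \<forall>y \<in> carrier H. \<pi> (\<alpha> (inv_into (carrier G) \<pi> y)) = \<beta> y)"
    by blast
qed

end
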